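(* Let $\alpha,\xi>0$, $\Delta t_m>0$, let $\vec X^m\in \underline V^h_{\partial_0}$, and let $(\vec X^{m+1},\mathcal Y^{m+1},\varkappa^{m+1})$, with $\vec X^{m+1}-\vec X^m\in\underline V^h_{\partial}$ and $\mathcal Y^{m+1},\varkappa^{m+1}\in V^h$, be a solution of the fully discrete scheme $$\frac{1}{\Delta t_m}\bigl\langle \vec X^{m+1}-\vec X^m,\ \chi\,\vec f^{\,m+\frac12}\bigr\rangle-\bigl\langle (\vec X^m\cdot\vec e_1)\,\mathcal Y^{m+1}_\rho,\ \chi_\rho\,|\vec X^m_\rho|^{-1}\bigr\rangle=0\qquad\forall\,\chi\in V^h,$$ $$\tfrac1\xi\bigl\langle (\vec X^m\cdot\vec e_1)\,\mathcal Y^{m+1}_\rho,\ \zeta_\rho\,|\vec X^m_\rho|^{-1}\bigr\rangle+\bigl\langle (\vec X^m\cdot\vec e_1)\,[\alpha^{-1}\mathcal Y^{m+1}-\varkappa^{m+1}],\ \zeta\,|\vec X^m_\rho|\bigr\rangle=0\qquad\forall\,\zeta\in V^h,$$ $$\bigl\langle \varkappa^{m+1}\,\vec f^{\,m+\frac12},\ \vec\eta\bigr\rangle+\bigl\langle \vec\eta\cdot\vec e_1,\ |\vec X^{m+1}_\rho|\bigr\rangle+\bigl\langle (\vec X^m\cdot\vec e_1)\,\vec X^{m+1}_\rho,\ \vec\eta_\rho\,|\vec X^m_\rho|^{-1}\bigr\rangle=0\qquad\forall\,\vec\eta\in\underline V^h_{\partial}.$$ Then $$A(\vec X^{m+1})+\frac{2\pi\,\Delta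 t_m}{\alpha}\bigl\langle (\vec X^m\cdot\vec e_1)\,|\mathcal Y^{m+1}_\rho|^2,\ |\vec X^m_\rho|^{-1}\bigr\rangle+2\pi\,\Delta t_m\,\xi\,\bigl\langle (\vec X^m\cdot\vec e_1)\,\bigl|\varkappa^{m+1}-\tfrac1\alpha\mathcal Y^{m+1}\bigr|^2,\ |\vec X^m_\rho|\bigr\rangle\le A(\vec X^m).$$ Moreover, $M(\vec X^{m+1})=M(\vec X^m)$.
   Context: Domain and boundary. Either $\mathbb I=\mathbb R/\mathbb Z$ (with $\partial\mathbb I=\emptyset$) or $\mathbb I=(0,1)$ (with $\partial\mathbb I=\{0,1\}$). $\partial\mathbb I=\partial_D\mathbb I\cup\partial_0\mathbb I\cup\partial_1\mathbb I\cup\partial_2\mathbb I$ is a given disjoint partition. $\vec e_1,\vec e_2$ is the standard basis of $\mathbb R^2$; $\langle\cdot,\cdot\rangle$ is the $L^2$ inner product over $\mathbb I$ (scalar or vector valued); subscript $\rho$ is the derivative on $\mathbb I$ (piecewise for finite element functions); $(a,b)^\perp=(b,-a)$ is clockwise rotation by $\pi/2$. Finite element spaces. For an integer $J\ge3$, $h=1/J$, $q_j=jh$, $\mathbb I_j=[q_{j-1},q_j]$. $V^h$ is the space of continuous functions on $\overline{\mathbb I}$ that are affine on each $\mathbb I_j$ (periodic if $\mathbb I=\mathbb R/\mathbb Z$). $\underline V^h_{\partial_0}=\{\vec\eta\in[V^h]^2:\vec\eta(\rho)\cdot\vec e_1=0\ \forall\rho\in\partial_0\mathbb I\}$, and $\underline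 V^h_{\partial}=\{\vec\eta\in\underline V^h_{\partial_0}:\vec\eta(\rho)\cdot\vec e_i=0\ \forall\rho\in\partial_i\mathbb I,\ i=1,2;\ \vec\eta(\rho)=\vec 0\ \forall\rho\in\partial_D\mathbb I\}$. Standing assumptions. For $\vec X\in\{\vec X^m,\vec X^{m+1}\}$: $\vec X\cdot\vec e_1>0$ in $\overline{\mathbb I}\setminus\partial_0\mathbb I$ and $|\vec X_\rho|>0$ in $\mathbb I$ (on each element). $\vec X$ parameterizes the generating curve of a surface rotationally symmetric about the $x_2$-axis. Time-averaged weighted normal: $$\vec f^{\,m+\frac12}=-\tfrac16\Bigl(2(\vec X^m\cdot\vec e_1)\vec X^m_\rho+2(\vec X^{m+1}\cdot\vec e_1)\vec X^{m+1}_\rho+(\vec X^m\cdot\vec e_1)\vec X^{m+1}_\rho+(\vec X^{m+1}\cdot\vec e_1)\vec X^m_\rho\Bigr)^\perp .$$ Surface area: $A(\vec X)=2\pi\int_{\mathbb I}(\vec X\cdot\vec e_1)\,|\vec X_\rho|\,d\rho$. Enclosed volume (up to an additive constant): $M(\vec X)=\pi\langle(\vec X\cdot\vec e_1)^2\,\vec\nu,\ \vec e_1\,|\vec X_\rho|\rangle+\pi\sum_{p\in\partial_1\mathbb I}(-1)^{p+1}(\vec X(p)\cdot\vec e_1)^2\,\vec X(p)\cdot\vec e_2$, where $\vec\nu=-|\vec X_\rho|^{-1}(\vec X_\rho)^\perp$ is the unit normal (the parameterization being oriented so that $\vec\nu$ is the outer normal). *)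

theory Defs
  imports "HOL-Analysis.Analysis"
begin

text \<open>
  \<open>Circle\<close> is R/Z and \<open>Interval\<close> is (0,1). In both cases functions on the closure of the domain are
  represented by functions on the reals of which only the restriction to [0,1] matters; for
  \<open>Circle\<close> the end points 0 and 1 are identified, see \<open>Vh\<close>.
\<close>

datatype param_domain = Circle | Interval

fun bdry :: "param_domain \<Rightarrow> real set" where
  "bdry Circle = {}"
| "bdry Interval = {0, 1}"

definition boundary_partition ::
    "param_domain \<Rightarrow> real set \<Rightarrow> real set \<Rightarrow> real set \<Rightarrow> real set \<Rightarrow> bool" where
  "boundary_partition I dD d0 d1 d2 \<longleftrightarrow>
     bdry I = dD \<union> d0 \<union> d1 \<union> d2 \<and>
     dD \<inter> d0 = {} \<and> dD \<inter> d1 = {} \<and> dD \<inter> d2 = {} \<and>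
     d0 \<inter> d1 = {} \<and> d0 \<inter> d2 = {} \<and> d1 \<inter> d2 = {}"

abbreviation e1 :: "real ^ 2" where "e1 \<equiv> axis 1 1"
abbreviation e2 :: "real ^ 2" where "e2 \<equiv> axis 2 1"

definition perp :: "real ^ 2 \<Rightarrow> real ^ 2" where
  "perp v = vector [v $ 2, - (v $ 1)]"

definition L2 :: "(real \<Rightarrow> 'a::real_inner) \<Rightarrow> (real \<Rightarrow> 'a) \<Rightarrow> real" where
  "L2 f g = integral {0..1} (\<lambda>\<rho>. f \<rho> \<bullet> g \<rho>)"

text \<open>
  The piecewise derivative. It carries no information at the mesh nodes, where a finite element
  function need not be differentiable; they form a null set and do not affect any integral.
\<close>

definition d_rho :: "(real \<Rightarrow> 'a::real_normed_vector) \<Rightarrow> real \<Rightarrow> 'a" where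
  "d_rho f \<rho> = vector_derivative f (at \<rho>)"

definition node :: "nat \<Rightarrow> nat \<Rightarrow> real" where
  "node J j = real j * (1 / real J)"

definition Vh :: "param_domain \<Rightarrow> nat \<Rightarrow> (real \<Rightarrow> real) set" where
  "Vh I J = {\<phi>. continuous_on {0..1} \<phi> \<and>
                (\<forall>j\<in>{1..J}. \<exists>a b. \<forall>\<rho>\<in>{node J (j - 1)..node J j}. \<phi> \<rho> = a + b * \<rho>) \<and>
                (I = Circle \<longrightarrow> \<phi> 0 = \<phi> 1)}"

definition Vh2 :: "param_domain \<Rightarrow> nat \<Rightarrow> (real \<Rightarrow> real ^ 2) set" where
  "Vh2 I J = {\<eta>. \<forall>i. (\<lambda>\<rho>. \<eta> \<rho> $ i) \<in> Vh I J}"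

definition Vh_d0 :: "param_domain \<Rightarrow> nat \<Rightarrow> real set \<Rightarrow> (real \<Rightarrow> real ^ 2) set" where
  "Vh_d0 I J d0 = {\<eta> \<in> Vh2 I J. \<forall>\<rho>\<in>d0. \<eta> \<rho> \<bullet> e1 = 0}"

definition Vh_bdry ::
    "param_domain \<Rightarrow> nat \<Rightarrow> real set \<Rightarrow> real set \<Rightarrow> real set \<Rightarrow> real set \<Rightarrow> (real \<Rightarrow> real ^ 2) set" where
  "Vh_bdry I J dD d0 d1 d2 =
     {\<eta> \<in> Vh_d0 I J d0. (\<forall>\<rho>\<in>d1. \<eta> \<rho> \<bullet> e1 = 0) \<and> (\<forall>\<rho>\<in>d2. \<eta> \<rho> \<bullet> e2 = 0) \<and> (\<forall>\<rho>\<in>dD. \<eta> \<rho> = 0)}"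

text \<open>On an open element the one-sided piecewise derivative and \<open>d_rho\<close> coincide.\<close>

definition admissible_curve :: "nat \<Rightarrow> real set \<Rightarrow> (real \<Rightarrow> real ^ 2) \<Rightarrow> bool" where
  "admissible_curve J d0 X \<longleftrightarrow>
     (\<forall>\<rho>\<in>{0..1} - d0. X \<rho> \<bullet> e1 > 0) \<and>
     (\<forall>j\<in>{1..J}. \<forall>\<rho>\<in>{node J (j - 1)<..<node J j}. norm (d_rho X \<rho>) > 0)"

definition weighted_normal ::
    "(real \<Rightarrow> real ^ 2) \<Rightarrow> (real \<Rightarrow> real ^ 2) \<Rightarrow> real \<Rightarrow> real ^ 2" where
  "weighted_normal X X' \<rho> =
     - ((1 / 6) *\<^sub>R perp (2 *\<^sub>R (X \<rho> \<bullet> e1) *\<^sub>R d_rho X \<rho> + 2 *\<^sub>R (X' \<rho> \<bullet> e1) *\<^sub>R d_rho X' \<rho>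
                         + (X \<rho> \<bullet> e1) *\<^sub>R d_rho X' \<rho> + (X' \<rho> \<bullet> e1) *\<^sub>R d_rho X \<rho>))"

definition surface_area :: "(real \<Rightarrow> real ^ 2) \<Rightarrow> real" where
  "surface_area X = 2 * pi * integral {0..1} (\<lambda>\<rho>. (X \<rho> \<bullet> e1) * norm (d_rho X \<rho>))"

definition unit_normal :: "(real \<Rightarrow> real ^ 2) \<Rightarrow> real \<Rightarrow> real ^ 2" where
  "unit_normal X \<rho> = - (inverse (norm (d_rho X \<rho>)) *\<^sub>R perp (d_rho X \<rho>))"

text \<open>The parameter \<open>d1\<close> is a subset of \<open>{0, 1}\<close>, so the exponent below is \<open>p + 1\<close>.\<close>

definition enclosed_volume :: "real set \<Rightarrow> (real \<Rightarrow> real ^ 2) \<Rightarrow> real" where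
  "enclosed_volume d1 X =
     pi * L2 (\<lambda>\<rho>. (X \<rho> \<bullet> e1)\<^sup>2 *\<^sub>R unit_normal X \<rho>) (\<lambda>\<rho>. norm (d_rho X \<rho>) *\<^sub>R e1)
     + pi * (\<Sum>p\<in>d1. (- 1) ^ nat \<lfloor>p + 1\<rfloor> * (X p \<bullet> e1)\<^sup>2 * (X p \<bullet> e2))"

end

theory Submission
  imports Defs
begin

text \<open>
  Write \<open>r = X \<bullet> e1\<close>, \<open>z = X \<bullet> e2\<close>, \<open>\<delta> = X' - X\<close>, and \<open>f\<close> for the weighted normal.

  \<^bold>\<open>Area.\<close> The two elastic terms of the third equation, tested with \<open>\<delta>\<close>, dominate the change of the
  area density: \<open>v \<bullet> (v - u) / \<bar>u\<bar> \<ge> \<bar>v\<bar> - \<bar>u\<bar>\<close> by Cauchy-Schwarz and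
  \<open>(\<bar>v\<bar> - \<bar>u\<bar>)\<^sup>2 \<ge> 0\<close>, with \<open>u\<close>, \<open>v\<close> the derivatives of \<open>X\<close>, \<open>X'\<close>
  (\<open>area_element_increment_le\<close>, \<open>surface_area_increment_le\<close>). The third equation turns them into the
  curvature term \<open>-\<langle>\<kappa> f, \<delta>\<rangle>\<close>, which the first equation tested with \<open>\<kappa>\<close> turns into minus \<open>\<Delta>t\<close> times
  the weighted inner product \<open>D\<close> of the derivatives of \<open>Y\<close> and \<open>\<kappa>\<close>. Combining the second
  equation tested with \<open>\<kappa>\<close> and with \<open>Y\<close> completes the square and shows that \<open>D\<close> is exactly the sum
  of the two dissipation terms.

  \<^bold>\<open>Volume.\<close> Up to boundary terms the enclosed volume is \<open>- \<pi> \<integral> r\<^sup>2 z\<^sub>\<rho>\<close>, a cubic functional. Along the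
  segment from \<open>X\<close> to \<open>X'\<close> its derivative is, after an integration by parts, \<open>2 \<pi>\<close> times the pairing
  of \<open>\<delta>\<close> with the normal \<open>- r\<^sub>t (X\<^sub>t)\<^sub>\<rho>\<^sup>\<bottom>\<close> of the intermediate curve \<open>X\<^sub>t\<close>, weighted with its radius
  \<open>r\<^sub>t\<close>. The weights \<open>2/6\<close> and \<open>1/6\<close> in \<open>f\<close> are the integrals over \<open>t\<close> of \<open>(1 - t)\<^sup>2\<close> or \<open>t\<^sup>2\<close> and of
  \<open>t (1 - t)\<close>, so \<open>f\<close> is the exact average of these normals, and the volume increment equals
  \<open>2 \<pi> \<langle>\<delta>, f\<rangle>\<close> (\<open>enclosed_volume_increment\<close>); the boundary terms of the integration by parts are
  absorbed by the boundary sum of the volume (\<open>boundary_volume_balance\<close>). The first equation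
  tested with the constant \<open>1\<close> says that the increment vanishes.

  All integrands are piecewise continuous, with jumps only at the mesh nodes; so they are integrable,
  and pointwise statements may fail at the nodes.
\<close>

section \<open>Functions on a mesh\<close>

definition nodes :: "nat \<Rightarrow> real set" where
  "nodes J = node J ` {0..J}"

definition pw_affine :: "nat \<Rightarrow> (real \<Rightarrow> 'a::real_normed_vector) \<Rightarrow> bool" where
  "pw_affine J f \<longleftrightarrow>
     (\<forall>j\<in>{1..J}. \<exists>a b. \<forall>\<rho>\<in>{node J (j - 1)..node J j}. f \<rho> = a + \<rho> *\<^sub>R b)"

text \<open>
  The derivative \<open>d_rho\<close> is unspecified at the nodes, hence the two following notions only look at
  open elements. A constant on an element stays constant under any function whatsoever, in particular
  under the discontinuous \<open>inverse\<close>; this is how reciprocals of lengths are handled.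
\<close>

definition pw_const :: "nat \<Rightarrow> (real \<Rightarrow> 'a) \<Rightarrow> bool" where
  "pw_const J f \<longleftrightarrow> (\<forall>j\<in>{1..J}. \<exists>c. \<forall>\<rho>\<in>{node J (j - 1)<..<node J j}. f \<rho> = c)"

definition pw_continuous :: "nat \<Rightarrow> (real \<Rightarrow> 'a::real_normed_vector) \<Rightarrow> bool" where
  "pw_continuous J f \<longleftrightarrow>
     (\<forall>j\<in>{1..J}. \<exists>g. continuous_on {node J (j - 1)..node J j} g \<and>
                     (\<forall>\<rho>\<in>{node J (j - 1)<..<node J j}. f \<rho> = g \<rho>))"

lemma finite_nodes [simp]: "finite (nodes J)"
  by (simp add: nodes_def)

lemma node_mono: "i \<le> j \<Longrightarrow> node J i \<le> node J j"
  by (simp add: node_def divide_right_mono)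

text \<open>The index of the element is \<open>\<rho> * J\<close> rounded up.\<close>

lemma off_nodes_in_element:
  assumes "J \<ge> 1" and "\<rho> \<in> {0..1} - nodes J"
  obtains j where "j \<in> {1..J}" and "\<rho> \<in> {node J (j - 1)<..<node J j}"
proof -
  define j where "j = nat \<lceil>\<rho> * J\<rceil>"
  have "node J 0 \<in> nodes J"
    by (auto simp: nodes_def)
  then have "\<rho> \<noteq> 0" using assms(2) by (auto simp: node_def)
  then have pos: "\<rho> > 0" using assms(2) by auto
  have Jpos: "real J > 0" using assms(1) by simp
  have rJ: "0 < \<rho> * J" using pos Jpos by simp
  have cpos: "\<lceil>\<rho> * J\<rceil> \<ge> 1" using rJ by linarith
  have "\<rho> * real J \<le> 1 * real J" using assms(2) by (intro mult_right_mono) auto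
  then have "\<lceil>\<rho> * J\<rceil> \<le> int J" by linarith
  then have "j \<le> J" unfolding j_def by (simp only: nat_le_iff)
  moreover have "1 \<le> j" using nat_mono[OF cpos] unfolding j_def by simp
  ultimately have j: "j \<in> {1..J}" by simp
  have rj: "real j = of_int \<lceil>\<rho> * J\<rceil>" using cpos unfolding j_def by simp
  have up: "\<rho> * J \<le> real j" and lo: "real j - 1 < \<rho> * J"
    unfolding rj by linarith+
  have "node J j \<in> nodes J" using j by (auto simp: nodes_def)
  then have "\<rho> \<noteq> node J j" using assms(2) by auto
  moreover have "\<rho> \<le> node J j" using up Jpos by (simp add: node_def field_simps)
  moreover have "node J (j - 1) < \<rho>"
    using lo Jpos j by (simp add: node_def field_simps of_nat_diff)
  ultimately show ?thesis using that[OF j] by auto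
qed

lemma pw_const_compose: "pw_const J f \<Longrightarrow> pw_const J (\<lambda>\<rho>. F (f \<rho>))"
  unfolding pw_const_def by metis

lemma pw_continuous_binary:
  assumes "pw_continuous J f" and "pw_continuous J g"
    and F: "\<And>S u v. continuous_on S u \<Longrightarrow> continuous_on S v \<Longrightarrow>
              continuous_on S (\<lambda>\<rho>::real. F (u \<rho>) (v \<rho>))"
  shows "pw_continuous J (\<lambda>\<rho>. F (f \<rho>) (g \<rho>))"
  unfolding pw_continuous_def
proof
  fix j assume "j \<in> {1..J}"
  with assms(1,2) obtain u v where
    "continuous_on {node J (j - 1)..node J j} u" "\<forall>\<rho>\<in>{node J (j - 1)<..<node J j}. f \<rho> = u \<rho>"
    "continuous_on {node J (j - 1)..node J j} v" "\<forall>\<rho>\<in>{node J (j - 1)<..<node J j}. g \<rho> = v \<rho>"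
    unfolding pw_continuous_def by metis
  then show "\<exists>h. continuous_on {node J (j - 1)..node J j} h \<and>
      (\<forall>\<rho>\<in>{node J (j - 1)<..<node J j}. F (f \<rho>) (g \<rho>) = h \<rho>)"
    by (intro exI[of _ "\<lambda>\<rho>. F (u \<rho>) (v \<rho>)"]) (auto intro: F)
qed

lemma pw_const_imp_pw_continuous: "pw_const J f \<Longrightarrow> pw_continuous J f"
  unfolding pw_const_def pw_continuous_def by (metis continuous_on_const)

lemma pw_affine_imp_pw_continuous:
  assumes "pw_affine J f" shows "pw_continuous J f"
  unfolding pw_continuous_def
proof
  fix j assume "j \<in> {1..J}"
  with assms obtain a b where "\<forall>\<rho>\<in>{node J (j - 1)..node J j}. f \<rho> = a + \<rho> *\<^sub>R b"
    unfolding pw_affine_def by blast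
  then show "\<exists>g. continuous_on {node J (j - 1)..node J j} g \<and>
      (\<forall>\<rho>\<in>{node J (j - 1)<..<node J j}. f \<rho> = g \<rho>)"
    by (intro exI[of _ "\<lambda>\<rho>. a + \<rho> *\<^sub>R b"]) (auto intro!: continuous_intros)
qed

lemma pw_continuous_const: "pw_continuous J (\<lambda>\<rho>. c)"
  unfolding pw_continuous_def by (auto intro!: exI[of _ "\<lambda>\<rho>. c"] continuous_intros)

lemma pw_continuous_add:
  "pw_continuous J f \<Longrightarrow> pw_continuous J g \<Longrightarrow> pw_continuous J (\<lambda>\<rho>. f \<rho> + g \<rho>)"
  by (rule pw_continuous_binary) (auto intro: continuous_intros)

lemma pw_continuous_diff:
  "pw_continuous J f \<Longrightarrow> pw_continuous J g \<Longrightarrow> pw_continuous J (\<lambda>\<rho>. f \<rho> - g \<rho>)"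
  by (rule pw_continuous_binary) (auto intro: continuous_intros)

lemma pw_continuous_mult:
  fixes f g :: "real \<Rightarrow> real"
  shows "pw_continuous J f \<Longrightarrow> pw_continuous J g \<Longrightarrow> pw_continuous J (\<lambda>\<rho>. f \<rho> * g \<rho>)"
  by (rule pw_continuous_binary) (auto intro: continuous_intros)

lemma pw_continuous_scaleR:
  "pw_continuous J f \<Longrightarrow> pw_continuous J g \<Longrightarrow> pw_continuous J (\<lambda>\<rho>. f \<rho> *\<^sub>R g \<rho>)"
  by (rule pw_continuous_binary) (auto intro: continuous_intros)

lemma pw_continuous_inner:
  "pw_continuous J f \<Longrightarrow> pw_continuous J g \<Longrightarrow> pw_continuous J (\<lambda>\<rho>. f \<rho> \<bullet> g \<rho>)"
  by (rule pw_continuous_binary) (auto intro: continuous_intros)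

lemma bounded_linear_perp: "bounded_linear perp"
  by (rule linear_conv_bounded_linear[THEN iffD1], rule linearI)
     (simp_all add: perp_def vec_eq_iff forall_2)

lemma pw_continuous_perp:
  "pw_continuous J f \<Longrightarrow> pw_continuous J (\<lambda>\<rho>. perp (f \<rho>))"
  by (rule pw_continuous_binary[where g = f and F = "\<lambda>u v. perp u"])
     (auto intro: bounded_linear.continuous_on[OF bounded_linear_perp])

lemma pw_continuous_minus:
  "pw_continuous J f \<Longrightarrow> pw_continuous J (\<lambda>\<rho>. - f \<rho>)"
  by (rule pw_continuous_binary[where g = f and F = "\<lambda>u v. - u"]) (auto intro: continuous_intros)

lemmas pw_continuous_intros =
  pw_continuous_const pw_continuous_add pw_continuous_diff pw_continuous_mult
  pw_continuous_scaleR pw_continuous_inner pw_continuous_perp pw_continuous_minus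

text \<open>On one element the function differs from a continuous one at most at the two end points;
  the elements are then joined one after the other.\<close>

lemma pw_continuous_integrable:
  fixes f :: "real \<Rightarrow> real"
  assumes "J \<ge> 1" and f: "pw_continuous J f"
  shows "f integrable_on {0..1}"
proof -
  have "f integrable_on {node J 0..node J k}" if "k \<le> J" for k
    using that
  proof (induction k)
    case 0
    show ?case using integrable_on_refl[of f "node J 0"] unfolding box_real .
  next
    case (Suc k)
    then have "Suc k \<in> {1..J}" by simp
    with f obtain g where g: "continuous_on {node J k..node J (Suc k)} g"
      "\<forall>\<rho>\<in>{node J k<..<node J (Suc k)}. f \<rho> = g \<rho>"
      unfolding pw_continuous_def by fastforce
    have last: "f integrable_on {node J k..node J (Suc k)}"
      by (rule integrable_spike_finite[where S = "{node J k, node J (Suc k)}"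
            and f = g, OF _ _ integrable_continuous_interval[OF g(1)]])
         (use g(2) in auto)
    have init: "f integrable_on {node J 0..node J k}" using Suc by simp
    show ?case
      by (rule Henstock_Kurzweil_Integration.integrable_combine[OF _ _ init last])
         (rule node_mono; simp)+
  qed
  from this[of J] show ?thesis using assms(1) by (simp add: node_def)
qed

lemma affine_on_has_vector_derivative:
  assumes "\<forall>\<rho>\<in>{u..v}. f \<rho> = a + \<rho> *\<^sub>R b" and "\<rho> \<in> {u<..<v}"
  shows "(f has_vector_derivative b) (at \<rho>)"
proof -
  have "((\<lambda>\<rho>. a + \<rho> *\<^sub>R b) has_vector_derivative b) (at \<rho>)"
    by (auto intro!: derivative_eq_intros)
  then show ?thesis
    by (rule has_vector_derivative_transform_within_open[OF _ open_greaterThanLessThan assms(2)])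
       (use assms(1) in auto)
qed

lemma pw_affine_derivative:
  assumes "J \<ge> 1" and "pw_affine J f" and "\<rho> \<in> {0..1} - nodes J"
  shows "(f has_vector_derivative d_rho f \<rho>) (at \<rho>)"
proof -
  obtain j where j: "j \<in> {1..J}" "\<rho> \<in> {node J (j - 1)<..<node J j}"
    using off_nodes_in_element[OF assms(1,3)] .
  then obtain a b where f: "\<forall>\<rho>\<in>{node J (j - 1)..node J j}. f \<rho> = a + \<rho> *\<^sub>R b"
    using assms(2) unfolding pw_affine_def by blast
  from affine_on_has_vector_derivative[OF this j(2)] show ?thesis
    unfolding d_rho_def by (metis vector_derivative_at)
qed

lemma pw_const_d_rho:
  assumes "pw_affine J f" shows "pw_const J (d_rho f)"
  unfolding pw_const_def
proof
  fix j assume "j \<in> {1..J}"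
  then obtain a b where f: "\<forall>\<rho>\<in>{node J (j - 1)..node J j}. f \<rho> = a + \<rho> *\<^sub>R b"
    using assms unfolding pw_affine_def by blast
  have "d_rho f \<rho> = b" if "\<rho> \<in> {node J (j - 1)<..<node J j}" for \<rho>
    unfolding d_rho_def
    by (rule vector_derivative_at[OF affine_on_has_vector_derivative[OF f that]])
  then show "\<exists>c. \<forall>\<rho>\<in>{node J (j - 1)<..<node J j}. d_rho f \<rho> = c" by blast
qed

lemma integral_eq_off_nodes:
  fixes f g :: "real \<Rightarrow> real"
  assumes "\<And>\<rho>. \<rho> \<in> {0..1} - nodes J \<Longrightarrow> f \<rho> = g \<rho>"
  shows "integral {0..1} f = integral {0..1} g"
  by (rule integral_spike[where S = "nodes J"]) (use assms in auto)

lemma integral_le_off_nodes: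
  fixes f g :: "real \<Rightarrow> real"
  assumes "J \<ge> 1" and "pw_continuous J f" and "pw_continuous J g"
    and le: "\<And>\<rho>. \<rho> \<in> {0..1} - nodes J \<Longrightarrow> f \<rho> \<le> g \<rho>"
  shows "integral {0..1} f \<le> integral {0..1} g"
proof -
  have "g integrable_on {0..1}"
    using pw_continuous_integrable assms by blast
  moreover have "f integrable_on {0..1}"
    using pw_continuous_integrable assms by blast
  then have "(\<lambda>\<rho>. if \<rho> \<in> nodes J then g \<rho> else f \<rho>) integrable_on {0..1}"
    by (rule integrable_spike_finite[where S = "nodes J", rotated 2]) auto
  ultimately have "integral {0..1} (\<lambda>\<rho>. if \<rho> \<in> nodes J then g \<rho> else f \<rho>) \<le> integral {0..1} g"
    by (intro integral_le) (use le in auto)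
  moreover have "integral {0..1} (\<lambda>\<rho>. if \<rho> \<in> nodes J then g \<rho> else f \<rho>) = integral {0..1} f"
    by (rule integral_eq_off_nodes) auto
  ultimately show ?thesis by simp
qed

section \<open>The finite element spaces\<close>

lemma Vh_pw_affine:
  assumes "f \<in> Vh I J" shows "pw_affine J f"
  unfolding pw_affine_def
proof
  fix j assume "j \<in> {1..J}"
  with assms obtain a b where "\<forall>\<rho>\<in>{node J (j - 1)..node J j}. f \<rho> = a + b * \<rho>"
    unfolding Vh_def by blast
  then show "\<exists>a b. \<forall>\<rho>\<in>{node J (j - 1)..node J j}. f \<rho> = a + \<rho> *\<^sub>R b"
    by (intro exI[of _ a] exI[of _ b]) (auto simp: mult.commute)
qed

lemma Vh2_pw_affine:
  assumes "f \<in> Vh2 I J" shows "pw_affine J f"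
  unfolding pw_affine_def
proof
  fix j assume "j \<in> {1..J}"
  with assms have "\<forall>i. \<exists>a b. \<forall>\<rho>\<in>{node J (j - 1)..node J j}. f \<rho> $ i = a + b * \<rho>"
    unfolding Vh2_def Vh_def by blast
  then obtain a b where "\<forall>i. \<forall>\<rho>\<in>{node J (j - 1)..node J j}. f \<rho> $ i = a i + b i * \<rho>"
    by metis
  then show "\<exists>a b. \<forall>\<rho>\<in>{node J (j - 1)..node J j}. f \<rho> = a + \<rho> *\<^sub>R b"
    by (intro exI[of _ "\<chi> i. a i"] exI[of _ "\<chi> i. b i"]) (auto simp: vec_eq_iff mult.commute)
qed

lemma Vh2_continuous: "f \<in> Vh2 I J \<Longrightarrow> continuous_on {0..1} (\<lambda>\<rho>. f \<rho> $ i)"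
  unfolding Vh2_def Vh_def by blast

lemma Vh2_periodic: "f \<in> Vh2 Circle J \<Longrightarrow> f 0 = f 1"
  unfolding Vh2_def Vh_def by (auto simp: vec_eq_iff)

lemma const_in_Vh: "(\<lambda>\<rho>. c) \<in> Vh I J"
proof -
  have "\<exists>a b. \<forall>\<rho>\<in>{node J (j - 1)..node J j}. c = a + b * \<rho>" for j
    by (rule exI[of _ c], rule exI[of _ 0]) simp
  then show ?thesis unfolding Vh_def by simp
qed

lemma Vh_add:
  assumes "f \<in> Vh I J" and "g \<in> Vh I J"
  shows "(\<lambda>\<rho>. f \<rho> + g \<rho>) \<in> Vh I J"
proof -
  have "\<exists>a b. \<forall>\<rho>\<in>{node J (j - 1)..node J j}. f \<rho> + g \<rho> = a + b * \<rho>" if j: "j \<in> {1..J}" for j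
  proof -
    from assms j obtain a b c d where
      "\<forall>\<rho>\<in>{node J (j - 1)..node J j}. f \<rho> = a + b * \<rho>"
      "\<forall>\<rho>\<in>{node J (j - 1)..node J j}. g \<rho> = c + d * \<rho>"
      unfolding Vh_def by blast
    then show ?thesis
      by (intro exI[of _ "a + c"] exI[of _ "b + d"]) (auto simp: algebra_simps)
  qed
  with assms show ?thesis
    unfolding Vh_def by (auto intro!: continuous_intros)
qed

lemma Vh2_from_increment:
  assumes "X \<in> Vh2 I J" and "(\<lambda>\<rho>. X' \<rho> - X \<rho>) \<in> Vh2 I J"
  shows "X' \<in> Vh2 I J"
proof -
  have "(\<lambda>\<rho>. X \<rho> $ i + (X' \<rho> - X \<rho>) $ i) \<in> Vh I J" for i
    using assms by (intro Vh_add) (auto simp: Vh2_def)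
  then show ?thesis by (simp add: Vh2_def)
qed

lemma admissible_d_rho_nonzero:
  assumes "J \<ge> 1" and "admissible_curve J d0 X" and "\<rho> \<in> {0..1} - nodes J"
  shows "d_rho X \<rho> \<noteq> 0"
  using off_nodes_in_element[OF assms(1,3)] assms(2) unfolding admissible_curve_def
  by (metis less_irrefl norm_zero)

lemma Vh_d0_radius_nonneg:
  assumes "X \<in> Vh_d0 I J d0" and "admissible_curve J d0 X" and "\<rho> \<in> {0..1}"
  shows "X \<rho> \<bullet> e1 \<ge> 0"
  using assms by (cases "\<rho> \<in> d0") (auto simp: admissible_curve_def Vh_d0_def less_imp_le)

lemmas Vh2_pw_continuous = Vh2_pw_affine[THEN pw_affine_imp_pw_continuous]

lemmas Vh2_pw_const_d_rho = Vh2_pw_affine[THEN pw_const_d_rho]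

lemma weighted_normal_pw_continuous:
  assumes "X \<in> Vh2 I J" and "X' \<in> Vh2 I J"
  shows "pw_continuous J (weighted_normal X X')"
  unfolding weighted_normal_def[abs_def]
  by (intro pw_continuous_intros pw_const_imp_pw_continuous
      Vh2_pw_continuous[OF assms(1)] Vh2_pw_continuous[OF assms(2)]
      Vh2_pw_const_d_rho[OF assms(1)] Vh2_pw_const_d_rho[OF assms(2)])

section \<open>The area increment\<close>

text \<open>
  After multiplication by \<open>norm u\<close> the inequality \<open>norm v - norm u \<le> v \<bullet> (v - u) / norm u\<close> is
  Cauchy-Schwarz plus \<open>0 \<le> (norm v - norm u)\<^sup>2\<close>. Adding \<open>(r' - r) * norm v\<close> to \<open>r\<close> times it gives
  the claim, which is the pointwise form of the area estimate with old radius \<open>r\<close> and new radius \<open>r'\<close>.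
\<close>

lemma area_element_increment_le:
  fixes u v :: "'a::real_inner"
  assumes "u \<noteq> 0" and "r \<ge> 0"
  shows "r' * norm v - r * norm u
           \<le> (r' - r) * norm v + (r *\<^sub>R v) \<bullet> (inverse (norm u) *\<^sub>R (v - u))"
proof -
  have pos: "norm u > 0" using assms by simp
  have "norm v - norm u \<le> (v \<bullet> (v - u)) / norm u"
  proof -
    have "v \<bullet> u \<le> norm v * norm u" by (rule norm_cauchy_schwarz)
    moreover have "0 \<le> (norm v - norm u)\<^sup>2" by simp
    ultimately have "(norm v - norm u) * norm u \<le> v \<bullet> (v - u)"
      by (simp add: inner_diff_right dot_square_norm power2_eq_square algebra_simps)
    then show ?thesis using pos by (simp add: pos_le_divide_eq)
  qed
  then have "r * (norm v - norm u) \<le> r * ((v \<bullet> (v - u)) / norm u)"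
    using assms(2) by (rule mult_left_mono)
  then show ?thesis by (simp add: algebra_simps divide_inverse)
qed

text \<open>The right-hand side consists of the two terms of the curvature equation other than the
  curvature term, tested with the increment \<open>X' - X\<close>.\<close>

lemma surface_area_increment_le:
  assumes J: "J \<ge> 1" and X: "X \<in> Vh_d0 I J d0" and dV: "(\<lambda>\<rho>. X' \<rho> - X \<rho>) \<in> Vh2 I J"
    and adm: "admissible_curve J d0 X"
  defines "\<delta> \<equiv> \<lambda>\<rho>. X' \<rho> - X \<rho>"
  shows "surface_area X' - surface_area X \<le> 2 * pi *
    (L2 (\<lambda>\<rho>. \<delta> \<rho> \<bullet> e1) (\<lambda>\<rho>. norm (d_rho X' \<rho>))
     + L2 (\<lambda>\<rho>. (X \<rho> \<bullet> e1) *\<^sub>R d_rho X' \<rho>) (\<lambda>\<rho>. inverse (norm (d_rho X \<rho>)) *\<^sub>R d_rho \<delta> \<rho>))"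
proof -
  have XV: "X \<in> Vh2 I J" using X by (simp add: Vh_d0_def)
  have XV': "X' \<in> Vh2 I J" using XV dV by (rule Vh2_from_increment)
  have \<delta>V: "\<delta> \<in> Vh2 I J" using dV by (simp add: \<delta>_def)
  note V = XV XV' \<delta>V
  have ncont: "pw_continuous J (\<lambda>\<rho>. norm (d_rho X \<rho>))" "pw_continuous J (\<lambda>\<rho>. norm (d_rho X' \<rho>))"
    "pw_continuous J (\<lambda>\<rho>. inverse (norm (d_rho X \<rho>)))"
    by (rule pw_const_imp_pw_continuous, rule pw_const_compose, rule V[THEN Vh2_pw_const_d_rho])+
  note pwc = pw_continuous_intros ncont V[THEN Vh2_pw_continuous]
    V[THEN Vh2_pw_const_d_rho, THEN pw_const_imp_pw_continuous]
  note int = pw_continuous_integrable[OF J]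
  let ?Q = "\<lambda>\<rho>. (\<delta> \<rho> \<bullet> e1) \<bullet> norm (d_rho X' \<rho>)"
  let ?S = "\<lambda>\<rho>. ((X \<rho> \<bullet> e1) *\<^sub>R d_rho X' \<rho>) \<bullet> (inverse (norm (d_rho X \<rho>)) *\<^sub>R d_rho \<delta> \<rho>)"
  have QS: "pw_continuous J ?Q" "pw_continuous J ?S" by (intro pwc)+
  have A: "pw_continuous J (\<lambda>\<rho>. (X \<rho> \<bullet> e1) * norm (d_rho X \<rho>))"
    "pw_continuous J (\<lambda>\<rho>. (X' \<rho> \<bullet> e1) * norm (d_rho X' \<rho>))" by (intro pwc)+
  have "integral {0..1} (\<lambda>\<rho>. (X' \<rho> \<bullet> e1) * norm (d_rho X' \<rho>) - (X \<rho> \<bullet> e1) * norm (d_rho X \<rho>))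
        \<le> integral {0..1} (\<lambda>\<rho>. ?Q \<rho> + ?S \<rho>)"
  proof (rule integral_le_off_nodes[OF J])
    fix \<rho> assume \<rho>: "\<rho> \<in> {0..1} - nodes J"
    have "d_rho \<delta> \<rho> = d_rho X' \<rho> - d_rho X \<rho>"
      unfolding d_rho_def[of \<delta>] unfolding \<delta>_def
      by (intro vector_derivative_at has_vector_derivative_diff
          pw_affine_derivative[OF J _ \<rho>] V[THEN Vh2_pw_affine])
    then show "(X' \<rho> \<bullet> e1) * norm (d_rho X' \<rho>) - (X \<rho> \<bullet> e1) * norm (d_rho X \<rho>) \<le> ?Q \<rho> + ?S \<rho>"
      using area_element_increment_le[OF admissible_d_rho_nonzero[OF J adm \<rho>]
          Vh_d0_radius_nonneg[OF X adm], of \<rho> "X' \<rho> \<bullet> e1" "d_rho X' \<rho>"] \<rho>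
      by (simp add: \<delta>_def inner_diff_left)
  qed (intro pwc)+
  also have "\<dots> = integral {0..1} ?Q + integral {0..1} ?S"
    by (rule integral_add) (intro int QS)+
  finally have "integral {0..1} (\<lambda>\<rho>. (X' \<rho> \<bullet> e1) * norm (d_rho X' \<rho>))
      - integral {0..1} (\<lambda>\<rho>. (X \<rho> \<bullet> e1) * norm (d_rho X \<rho>))
      \<le> integral {0..1} ?Q + integral {0..1} ?S"
    by (subst (asm) integral_diff) (intro int A)+
  then have "2 * pi * (integral {0..1} (\<lambda>\<rho>. (X' \<rho> \<bullet> e1) * norm (d_rho X' \<rho>))
      - integral {0..1} (\<lambda>\<rho>. (X \<rho> \<bullet> e1) * norm (d_rho X \<rho>)))
      \<le> 2 * pi * (integral {0..1} ?Q + integral {0..1} ?S)"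
    by (intro mult_left_mono) auto
  then show ?thesis unfolding surface_area_def L2_def by (simp only: right_diff_distrib)
qed

section \<open>The volume increment\<close>

text \<open>
  The primitive \<open>B\<close> is the boundary term of the integration by parts along the segment of curves: the
  factor \<open>((X $ 1)\<^sup>2 + X $ 1 * X' $ 1 + (X' $ 1)\<^sup>2) / 3\<close> is the integral over \<open>t \<in> [0, 1]\<close> of the
  squared radius \<open>((1 - t) * X $ 1 + t * X' $ 1)\<^sup>2\<close>. Differentiating \<open>B\<close> gives an identity of
  polynomials in the components of the curves and their derivatives.
\<close>

lemma volume_increment_has_integral:
  fixes X X' :: "real \<Rightarrow> real ^ 2"
  assumes J: "J \<ge> 1" and X: "X \<in> Vh2 I J" and X': "X' \<in> Vh2 I J"
  defines "B \<equiv> \<lambda>\<rho>. ((X \<rho> $ 1)\<^sup>2 + X \<rho> $ 1 * X' \<rho> $ 1 + (X' \<rho> $ 1)\<^sup>2) * (X' \<rho> $ 2 - X \<rho> $ 2) / 3"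
  shows "((\<lambda>\<rho>. 2 * ((X' \<rho> - X \<rho>) \<bullet> weighted_normal X X' \<rho>)
             + (X' \<rho> $ 1)\<^sup>2 * d_rho X' \<rho> $ 2 - (X \<rho> $ 1)\<^sup>2 * d_rho X \<rho> $ 2)
          has_integral (B 1 - B 0)) {0..1}"
proof (rule fundamental_theorem_of_calculus_interior_strong[where S = "nodes J"])
  show "continuous_on {0..1} B"
    unfolding B_def by (intro continuous_intros Vh2_continuous[OF X] Vh2_continuous[OF X']) simp
next
  fix \<rho> :: real assume "\<rho> \<in> {0<..<1} - nodes J"
  then have \<rho>: "\<rho> \<in> {0..1} - nodes J" by auto
  have D: "((\<lambda>\<rho>. X \<rho> $ i) has_real_derivative d_rho X \<rho> $ i) (at \<rho>)"
       "((\<lambda>\<rho>. X' \<rho> $ i) has_real_derivative d_rho X' \<rho> $ i) (at \<rho>)" for i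
    using pw_affine_derivative[OF J Vh2_pw_affine[OF X] \<rho>]
          pw_affine_derivative[OF J Vh2_pw_affine[OF X'] \<rho>]
    by (auto simp: has_real_derivative_iff_has_vector_derivative
             intro: bounded_linear.has_vector_derivative[OF bounded_linear_vec_nth])
  have "(B has_real_derivative
           2 * ((X' \<rho> - X \<rho>) \<bullet> weighted_normal X X' \<rho>)
             + (X' \<rho> $ 1)\<^sup>2 * d_rho X' \<rho> $ 2 - (X \<rho> $ 1)\<^sup>2 * d_rho X \<rho> $ 2) (at \<rho>)"
    unfolding B_def
    by (rule derivative_eq_intros D refl | simp)+
       (simp add: weighted_normal_def perp_def inner_vec_def sum_2 axis_def
             power2_eq_square field_simps)
  then show "(B has_vector_derivative
           2 * ((X' \<rho> - X \<rho>) \<bullet> weighted_normal X X' \<rho>)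
             + (X' \<rho> $ 1)\<^sup>2 * d_rho X' \<rho> $ 2 - (X \<rho> $ 1)\<^sup>2 * d_rho X \<rho> $ 2) (at \<rho>)"
    by (simp add: has_real_derivative_iff_has_vector_derivative)
qed auto

text \<open>The length element cancels the normalisation of the unit normal; this fails only where the
  derivative vanishes, which admissibility confines to the nodes.\<close>

lemma enclosed_volume_eq:
  assumes J: "J \<ge> 1" and "admissible_curve J d0 X"
  shows "enclosed_volume d1 X =
     - pi * integral {0..1} (\<lambda>\<rho>. (X \<rho> $ 1)\<^sup>2 * d_rho X \<rho> $ 2)
     + pi * (\<Sum>p\<in>d1. (- 1) ^ nat \<lfloor>p + 1\<rfloor> * (X p $ 1)\<^sup>2 * X p $ 2)"
proof -
  have "L2 (\<lambda>\<rho>. (X \<rho> \<bullet> e1)\<^sup>2 *\<^sub>R unit_normal X \<rho>) (\<lambda>\<rho>. norm (d_rho X \<rho>) *\<^sub>R e1)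
        = integral {0..1} (\<lambda>\<rho>. - ((X \<rho> $ 1)\<^sup>2 * d_rho X \<rho> $ 2))"
    unfolding L2_def
  proof (rule integral_eq_off_nodes)
    fix \<rho> assume "\<rho> \<in> {0..1} - nodes J"
    from admissible_d_rho_nonzero[OF assms this]
    show "((X \<rho> \<bullet> e1)\<^sup>2 *\<^sub>R unit_normal X \<rho>) \<bullet> (norm (d_rho X \<rho>) *\<^sub>R e1)
          = - ((X \<rho> $ 1)\<^sup>2 * d_rho X \<rho> $ 2)"
      by (simp add: unit_normal_def perp_def inner_axis field_simps)
  qed
  then show ?thesis by (simp add: enclosed_volume_def inner_axis)
qed

text \<open>
  The boundary sum in the volume is there to compensate \<open>B\<close>. On a periodic domain both sides vanish.
  On an interval, \<open>B p\<close> vanishes for \<open>p\<close> outside \<open>d1\<close>: on \<open>d0\<close> both radii are zero, on \<open>dD\<close> and \<open>d2\<close>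
  the vertical increment is zero. On \<open>d1\<close> the radius does not change, so \<open>B p\<close> is exactly the
  increment of the summand, and the signs \<open>(- 1) ^ (p + 1)\<close> are those of \<open>B 1 - B 0\<close>.
\<close>

lemma boundary_volume_balance:
  fixes X X' :: "real \<Rightarrow> real ^ 2"
  assumes part: "boundary_partition I dD d0 d1 d2"
    and X: "X \<in> Vh_d0 I J d0" and X': "X' \<in> Vh2 I J"
    and d: "(\<lambda>\<rho>. X' \<rho> - X \<rho>) \<in> Vh_bdry I J dD d0 d1 d2"
  defines "B \<equiv> \<lambda>\<rho>. ((X \<rho> $ 1)\<^sup>2 + X \<rho> $ 1 * X' \<rho> $ 1 + (X' \<rho> $ 1)\<^sup>2) * (X' \<rho> $ 2 - X \<rho> $ 2) / 3"
    and "b \<equiv> \<lambda>Z :: real \<Rightarrow> real ^ 2. \<Sum>p\<in>d1. (- 1) ^ nat \<lfloor>p + 1\<rfloor> * (Z p $ 1)\<^sup>2 * Z p $ 2"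
  shows "B 1 - B 0 = b X' - b X"
proof (cases I)
  case Circle
  then have "d1 = {}" using part by (auto simp: boundary_partition_def)
  moreover have "B 0 = B 1"
    using X X' Circle Vh2_periodic[of X J] Vh2_periodic[of X' J]
    by (simp add: B_def Vh_d0_def)
  ultimately show ?thesis by (simp add: b_def)
next
  case Interval
  with part have bd: "{0, 1} = dD \<union> d0 \<union> d1 \<union> d2"
    by (auto simp: boundary_partition_def)
  have sub: "d1 \<subseteq> {0, 1}" using bd by blast
  have B0: "B p = 0" if "p \<in> {0, 1} - d1" for p
  proof -
    have "p \<in> dD \<or> p \<in> d0 \<or> p \<in> d2" using that bd by blast
    then show ?thesis
      using X d by (auto simp: B_def Vh_bdry_def Vh_d0_def inner_axis inner_diff_left)
  qed
  have B1: "B p = (X' p $ 1)\<^sup>2 * X' p $ 2 - (X p $ 1)\<^sup>2 * X p $ 2" if "p \<in> d1" for p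
  proof -
    have "X' p $ 1 = X p $ 1"
      using d that by (auto simp: Vh_bdry_def inner_axis)
    then show ?thesis by (simp add: B_def power2_eq_square field_simps)
  qed
  have "b X' - b X = (\<Sum>p\<in>d1. (- 1) ^ nat \<lfloor>p + 1\<rfloor> * B p)"
    unfolding b_def sum_subtractf[symmetric]
    by (rule sum.cong) (auto simp: B1 algebra_simps)
  also have "\<dots> = (\<Sum>p\<in>{0, 1}. (- 1) ^ nat \<lfloor>p + 1\<rfloor> * B p)"
    by (rule sum.mono_neutral_left) (use sub B0 in auto)
  also have "\<dots> = B 1 - B 0" by simp
  finally show ?thesis ..
qed

lemma enclosed_volume_increment:
  fixes X X' :: "real \<Rightarrow> real ^ 2"
  assumes J: "J \<ge> 1" and part: "boundary_partition I dD d0 d1 d2"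
    and X: "X \<in> Vh_d0 I J d0" and d: "(\<lambda>\<rho>. X' \<rho> - X \<rho>) \<in> Vh_bdry I J dD d0 d1 d2"
    and adm: "admissible_curve J d0 X" and adm': "admissible_curve J d0 X'"
  shows "enclosed_volume d1 X' - enclosed_volume d1 X
         = 2 * pi * L2 (\<lambda>\<rho>. X' \<rho> - X \<rho>) (weighted_normal X X')"
proof -
  have XV: "X \<in> Vh2 I J" and dV: "(\<lambda>\<rho>. X' \<rho> - X \<rho>) \<in> Vh2 I J"
    using X d by (auto simp: Vh_d0_def Vh_bdry_def)
  then have XV': "X' \<in> Vh2 I J" by (rule Vh2_from_increment)
  note pwc = pw_continuous_intros weighted_normal_pw_continuous[OF XV XV']
    XV[THEN Vh2_pw_continuous] XV'[THEN Vh2_pw_continuous]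
    XV[THEN Vh2_pw_const_d_rho, THEN pw_const_imp_pw_continuous]
    XV'[THEN Vh2_pw_const_d_rho, THEN pw_const_imp_pw_continuous]
  note int = pw_continuous_integrable[OF J]
  have nth: "pw_continuous J (\<lambda>\<rho>. Z \<rho> $ i)" if "pw_continuous J Z" for Z :: "real \<Rightarrow> real ^ 2" and i
    using pw_continuous_inner[OF that pw_continuous_const, of "axis i 1"] by (simp add: inner_axis)
  define B where "B = (\<lambda>\<rho>. ((X \<rho> $ 1)\<^sup>2 + X \<rho> $ 1 * X' \<rho> $ 1 + (X' \<rho> $ 1)\<^sup>2)
                            * (X' \<rho> $ 2 - X \<rho> $ 2) / 3)"
  define V where "V = (\<lambda>Z :: real \<Rightarrow> real ^ 2. integral {0..1} (\<lambda>\<rho>. (Z \<rho> $ 1)\<^sup>2 * d_rho Z \<rho> $ 2))"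
  define b where "b = (\<lambda>Z :: real \<Rightarrow> real ^ 2. \<Sum>p\<in>d1. (- 1) ^ nat \<lfloor>p + 1\<rfloor> * (Z p $ 1)\<^sup>2 * Z p $ 2)"
  define W where "W = L2 (\<lambda>\<rho>. X' \<rho> - X \<rho>) (weighted_normal X X')"
  have WI: "(\<lambda>\<rho>. 2 * ((X' \<rho> - X \<rho>) \<bullet> weighted_normal X X' \<rho>)) integrable_on {0..1}"
    by (intro int pwc)
  have VI: "(\<lambda>\<rho>. (X \<rho> $ 1)\<^sup>2 * d_rho X \<rho> $ 2) integrable_on {0..1}"
    "(\<lambda>\<rho>. (X' \<rho> $ 1)\<^sup>2 * d_rho X' \<rho> $ 2) integrable_on {0..1}"
    unfolding power2_eq_square by (intro int pwc nth)+
  have "b X' - b X = B 1 - B 0"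
    unfolding B_def b_def by (rule boundary_volume_balance[OF part X XV' d, symmetric])
  also have "\<dots> = integral {0..1} (\<lambda>\<rho>. 2 * ((X' \<rho> - X \<rho>) \<bullet> weighted_normal X X' \<rho>)
             + (X' \<rho> $ 1)\<^sup>2 * d_rho X' \<rho> $ 2 - (X \<rho> $ 1)\<^sup>2 * d_rho X \<rho> $ 2)"
    using volume_increment_has_integral[OF J XV XV'] unfolding B_def
    by (rule integral_unique[symmetric])
  also have "\<dots> = 2 * W + V X' - V X"
    unfolding V_def W_def L2_def
    by (subst integral_diff[OF integrable_add[OF WI VI(2)] VI(1)],
        subst integral_add[OF WI VI(2)]) simp
  finally have "pi * (b X' - b X) = pi * (2 * W + V X' - V X)"
    by (rule arg_cong)
  moreover have "enclosed_volume d1 X = - pi * V X + pi * b X"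
    unfolding V_def b_def by (rule enclosed_volume_eq[OF J adm])
  moreover have "enclosed_volume d1 X' = - pi * V X' + pi * b X'"
    unfolding V_def b_def by (rule enclosed_volume_eq[OF J adm'])
  ultimately show ?thesis
    unfolding W_def[symmetric] by (simp add: algebra_simps)
qed

section \<open>Stability and volume preservation\<close>

theorem theorem3p4:
  fixes I :: param_domain
    and dD d0 d1 d2 :: "real set"
    and J :: nat
    and \<alpha> \<xi> \<Delta>t :: real
    and X X' :: "real \<Rightarrow> real ^ 2"
    and Y \<kappa> :: "real \<Rightarrow> real"
  assumes partition: "boundary_partition I dD d0 d1 d2"
    and "J \<ge> 3" and "\<alpha> > 0" and "\<xi> > 0" and "\<Delta>t > 0"
    and "X \<in> Vh_d0 I J d0"
    and "(\<lambda>\<rho>. X' \<rho> - X \<rho>) \<in> Vh_bdry I J dD d0 d1 d2"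
    and "Y \<in> Vh I J" and "\<kappa> \<in> Vh I J"
    and "admissible_curve J d0 X" and "admissible_curve J d0 X'"
    and scheme1: "\<And>\<phi>. \<phi> \<in> Vh I J \<Longrightarrow>
      (1 / \<Delta>t) * L2 (\<lambda>\<rho>. X' \<rho> - X \<rho>) (\<lambda>\<rho>. \<phi> \<rho> *\<^sub>R weighted_normal X X' \<rho>)
      - L2 (\<lambda>\<rho>. (X \<rho> \<bullet> e1) * d_rho Y \<rho>) (\<lambda>\<rho>. d_rho \<phi> \<rho> * inverse (norm (d_rho X \<rho>))) = 0"
    and scheme2: "\<And>\<zeta>. \<zeta> \<in> Vh I J \<Longrightarrow>
      (1 / \<xi>) * L2 (\<lambda>\<rho>. (X \<rho> \<bullet> e1) * d_rho Y \<rho>) (\<lambda>\<rho>. d_rho \<zeta> \<rho> * inverse (norm (d_rho X \<rho>)))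
      + L2 (\<lambda>\<rho>. (X \<rho> \<bullet> e1) * (inverse \<alpha> * Y \<rho> - \<kappa> \<rho>)) (\<lambda>\<rho>. \<zeta> \<rho> * norm (d_rho X \<rho>)) = 0"
    and scheme3: "\<And>\<eta>. \<eta> \<in> Vh_bdry I J dD d0 d1 d2 \<Longrightarrow>
      L2 (\<lambda>\<rho>. \<kappa> \<rho> *\<^sub>R weighted_normal X X' \<rho>) \<eta>
      + L2 (\<lambda>\<rho>. \<eta> \<rho> \<bullet> e1) (\<lambda>\<rho>. norm (d_rho X' \<rho>))
      + L2 (\<lambda>\<rho>. (X \<rho> \<bullet> e1) *\<^sub>R d_rho X' \<rho>) (\<lambda>\<rho>. inverse (norm (d_rho X \<rho>)) *\<^sub>R d_rho \<eta> \<rho>) = 0"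
  shows "surface_area X'
      + 2 * pi * \<Delta>t / \<alpha>
          * L2 (\<lambda>\<rho>. (X \<rho> \<bullet> e1) * \<bar>d_rho Y \<rho>\<bar>\<^sup>2) (\<lambda>\<rho>. inverse (norm (d_rho X \<rho>)))
      + 2 * pi * \<Delta>t * \<xi>
          * L2 (\<lambda>\<rho>. (X \<rho> \<bullet> e1) * \<bar>\<kappa> \<rho> - 1 / \<alpha> * Y \<rho>\<bar>\<^sup>2) (\<lambda>\<rho>. norm (d_rho X \<rho>))
      \<le> surface_area X
    \<and> enclosed_volume d1 X' = enclosed_volume d1 X"
proof
  note X = \<open>X \<in> Vh_d0 I J d0\<close> and d = \<open>(\<lambda>\<rho>. X' \<rho> - X \<rho>) \<in> Vh_bdry I J dD d0 d1 d2\<close>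
    and Y = \<open>Y \<in> Vh I J\<close> and K = \<open>\<kappa> \<in> Vh I J\<close>
    and adm = \<open>admissible_curve J d0 X\<close> and adm' = \<open>admissible_curve J d0 X'\<close>
  have J: "J \<ge> 1" using \<open>J \<ge> 3\<close> by simp
  have XV: "X \<in> Vh2 I J" and dV: "(\<lambda>\<rho>. X' \<rho> - X \<rho>) \<in> Vh2 I J"
    using X d by (auto simp: Vh_d0_def Vh_bdry_def)
  have ncont: "pw_continuous J (\<lambda>\<rho>. norm (d_rho X \<rho>))"
    by (rule pw_const_imp_pw_continuous, rule pw_const_compose, rule Vh2_pw_const_d_rho[OF XV])
  note pwc = pw_continuous_intros Vh2_pw_continuous[OF XV] ncont
    Y[THEN Vh_pw_affine, THEN pw_affine_imp_pw_continuous]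
    K[THEN Vh_pw_affine, THEN pw_affine_imp_pw_continuous]
  note int = pw_continuous_integrable[OF J]

  define D where "D = L2 (\<lambda>\<rho>. (X \<rho> \<bullet> e1) * d_rho Y \<rho>) (\<lambda>\<rho>. d_rho \<kappa> \<rho> * inverse (norm (d_rho X \<rho>)))"
  define E where "E = L2 (\<lambda>\<rho>. (X \<rho> \<bullet> e1) * d_rho Y \<rho>) (\<lambda>\<rho>. d_rho Y \<rho> * inverse (norm (d_rho X \<rho>)))"
  define R where "R = (\<lambda>\<zeta>. L2 (\<lambda>\<rho>. (X \<rho> \<bullet> e1) * (inverse \<alpha> * Y \<rho> - \<kappa> \<rho>)) (\<lambda>\<rho>. \<zeta> \<rho> * norm (d_rho X \<rho>)))"

  have "L2 (\<lambda>\<rho>. (X' \<rho> - X \<rho>) \<bullet> e1) (\<lambda>\<rho>. norm (d_rho X' \<rho>))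
      + L2 (\<lambda>\<rho>. (X \<rho> \<bullet> e1) *\<^sub>R d_rho X' \<rho>)
           (\<lambda>\<rho>. inverse (norm (d_rho X \<rho>)) *\<^sub>R d_rho (\<lambda>\<rho>. X' \<rho> - X \<rho>) \<rho>)
      = - L2 (\<lambda>\<rho>. \<kappa> \<rho> *\<^sub>R weighted_normal X X' \<rho>) (\<lambda>\<rho>. X' \<rho> - X \<rho>)"
    using scheme3[OF d] by linarith
  then have "surface_area X' - surface_area X
        \<le> 2 * pi * - L2 (\<lambda>\<rho>. \<kappa> \<rho> *\<^sub>R weighted_normal X X' \<rho>) (\<lambda>\<rho>. X' \<rho> - X \<rho>)"
    using surface_area_increment_le[OF J X dV adm] by (simp only:)
  also have "L2 (\<lambda>\<rho>. \<kappa> \<rho> *\<^sub>R weighted_normal X X' \<rho>) (\<lambda>\<rho>. X' \<rho> - X \<rho>)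
             = L2 (\<lambda>\<rho>. X' \<rho> - X \<rho>) (\<lambda>\<rho>. \<kappa> \<rho> *\<^sub>R weighted_normal X X' \<rho>)"
    unfolding L2_def by (simp add: inner_commute)
  also have "\<dots> = \<Delta>t * D"
    using scheme1[OF K] \<open>\<Delta>t > 0\<close> unfolding D_def by (simp add: field_simps)
  finally have area: "surface_area X' - surface_area X \<le> - 2 * pi * \<Delta>t * D" by simp

  have E: "L2 (\<lambda>\<rho>. (X \<rho> \<bullet> e1) * \<bar>d_rho Y \<rho>\<bar>\<^sup>2) (\<lambda>\<rho>. inverse (norm (d_rho X \<rho>))) = E"
    unfolding E_def L2_def by (simp add: power2_eq_square mult_ac)
  have RY: "\<xi> * R Y = - E" and RK: "\<xi> * R \<kappa> = - D"
    using scheme2[OF Y] scheme2[OF K] \<open>\<xi> > 0\<close>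
    unfolding E_def D_def R_def by (auto simp: field_simps)
  \<comment> \<open>Expanding one factor of the square leaves \<open>R\<close> tested with \<open>Y\<close> and with \<open>\<kappa>\<close>.\<close>
  have "L2 (\<lambda>\<rho>. (X \<rho> \<bullet> e1) * \<bar>\<kappa> \<rho> - 1 / \<alpha> * Y \<rho>\<bar>\<^sup>2) (\<lambda>\<rho>. norm (d_rho X \<rho>))
      = integral {0..1} (\<lambda>\<rho>.
          inverse \<alpha> * (((X \<rho> \<bullet> e1) * (inverse \<alpha> * Y \<rho> - \<kappa> \<rho>)) \<bullet> (Y \<rho> * norm (d_rho X \<rho>)))
          - ((X \<rho> \<bullet> e1) * (inverse \<alpha> * Y \<rho> - \<kappa> \<rho>)) \<bullet> (\<kappa> \<rho> * norm (d_rho X \<rho>)))"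
    unfolding L2_def
    by (intro arg_cong[where f = "integral {0..1}"] ext)
       (simp add: power2_eq_square divide_inverse algebra_simps)
  also have "\<dots> = inverse \<alpha> * R Y - R \<kappa>"
    unfolding R_def L2_def
    by (subst integral_diff) (intro int pwc | simp)+
  finally have "\<xi> * L2 (\<lambda>\<rho>. (X \<rho> \<bullet> e1) * \<bar>\<kappa> \<rho> - 1 / \<alpha> * Y \<rho>\<bar>\<^sup>2) (\<lambda>\<rho>. norm (d_rho X \<rho>))
      = \<xi> * (inverse \<alpha> * R Y - R \<kappa>)"
    by (rule arg_cong)
  also have "\<dots> = inverse \<alpha> * (\<xi> * R Y) - \<xi> * R \<kappa>"
    by (simp add: algebra_simps)
  finally have F: "\<xi> * L2 (\<lambda>\<rho>. (X \<rho> \<bullet> e1) * \<bar>\<kappa> \<rho> - 1 / \<alpha> * Y \<rho>\<bar>\<^sup>2) (\<lambda>\<rho>. norm (d_rho X \<rho>))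
      = D - E / \<alpha>"
    unfolding RY RK by (simp add: divide_inverse)
  have "2 * pi * \<Delta>t / \<alpha> * E + 2 * pi * \<Delta>t * (D - E / \<alpha>) = 2 * pi * \<Delta>t * D"
    by (simp add: algebra_simps)
  with area show "surface_area X'
      + 2 * pi * \<Delta>t / \<alpha>
          * L2 (\<lambda>\<rho>. (X \<rho> \<bullet> e1) * \<bar>d_rho Y \<rho>\<bar>\<^sup>2) (\<lambda>\<rho>. inverse (norm (d_rho X \<rho>)))
      + 2 * pi * \<Delta>t * \<xi>
          * L2 (\<lambda>\<rho>. (X \<rho> \<bullet> e1) * \<bar>\<kappa> \<rho> - 1 / \<alpha> * Y \<rho>\<bar>\<^sup>2) (\<lambda>\<rho>. norm (d_rho X \<rho>))
      \<le> surface_area X"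
    unfolding E mult.assoc[of "2 * pi * \<Delta>t" \<xi>] F by linarith

  \<comment> \<open>The test function \<open>1\<close> lies in the space \<open>Vh\<close>, which carries no boundary conditions.\<close>
  have "d_rho (\<lambda>\<rho>. 1::real) = (\<lambda>\<rho>. 0)"
    by (simp add: d_rho_def fun_eq_iff)
  then have "L2 (\<lambda>\<rho>. X' \<rho> - X \<rho>) (weighted_normal X X') = 0"
    using scheme1[OF const_in_Vh[of 1]] \<open>\<Delta>t > 0\<close> by (simp add: L2_def)
  then show "enclosed_volume d1 X' = enclosed_volume d1 X"
    using enclosed_volume_increment[OF J partition X d adm adm'] by simp
qed

end
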